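(* Let $X$ be an abstract state space. Then the set $\Xi^{u}(X)$ of uniformly ergodic $C_0$-Markov semigroups is $\rho_1$-dense and $\rho_1$-open in the set $\Xi(X)$ of all $C_0$-Markov semigroups on $X$.
   Context: Abstract state space: $X$ is an ordered (real) vector space with a generating positive cone $X_+$ (i.e. $X=X_+-X_+$), and $f$ is a strictly positive linear functional on $X$ such that $\mathcal{K}=\{x\in X_+: f(x)=1\}$ is a base of $X_+$. With $U:=\mathrm{conv}(\mathcal{K}\cup(-\mathcal{K}))$ put $\|x\|=\inf\{\lambda\in\mathbb{R}_+: x\in\lambda U\}$. It is assumed that $\|\cdot\|$ is a norm, that $X$ is complete for it, and that $X_+$ is closed; then $(X,X_+,\mathcal{K},f)$ (or simply $X$) is an abstract state space. A linear operator $T:X\to X$ is positive if $Tx\ge 0$ whenever $x\ge 0$; a positive linear operator with $T(\mathcal{K})\subset\mathcal{K}$ is called Markov. A $C_0$-Markov semigroup is a family $\mathcal{T}=(T_t)_{t\ge0}$ of Markov operators on $X$ with $T_0=I$, $T_{t+s}=T_tT_s$ for all $t,s\ge0$, and $\|T_tx-x\|\to0$ as $t\downarrow0$ for every $x\in X$. $\Xi(X)$ is the set of all $C_0$-Markov semigroups on $X$. A semigroup $\mathcal{T}\in\Xi(X)$ is uniformly ergodic if there is a one-dimensional projection $P$ on $X$ with $\lim_{t\to\infty}\|T_t-P\|=0$ (operator norm), and $$\Xi^{u}(X)=\{\mathcal{T}\in\Xi(X):\mathcal{T}\text{ is uniformly ergodic}\}.$$ The metric $\rho_1$ is $\rho_1(\mathcal{T},\mathcal{S})=\sup_{t\in[0,1]}\|T_t-S_t\|$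 for $\mathcal{T},\mathcal{S}\in\Xi(X)$. *)

theory Defs
  imports "HOL-Analysis.Analysis"
begin

section \<open>Abstract state spaces\<close>

text \<open>The positive cone is \<open>{x. 0 \<le> x}\<close>. As usual for bases of cones, a base is nonempty; this
  excludes the zero space.\<close>

definition is_base_of_cone :: "'a::real_vector set \<Rightarrow> 'a set \<Rightarrow> bool" where
  "is_base_of_cone K C \<longleftrightarrow>
     K \<noteq> {} \<and> convex K \<and> K \<subseteq> C \<and>
     (\<forall>x\<in>C. x \<noteq> 0 \<longrightarrow> (\<exists>!(c, k). 0 < c \<and> k \<in> K \<and> x = c *\<^sub>R k))"

definition states :: "('a::ordered_real_vector \<Rightarrow> real) \<Rightarrow> 'a set" where
  "states f = {x. 0 \<le> x \<and> f x = 1}"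

definition state_unit_hull :: "('a::ordered_real_vector \<Rightarrow> real) \<Rightarrow> 'a set" where
  "state_unit_hull f = convex hull (states f \<union> uminus ` states f)"

text \<open>That the base norm is a norm and that the space is complete for it is expressed by
  the class \<open>banach\<close> together with the assumption \<open>norm_eq\<close>, which says that the norm of the
  class is the base norm.\<close>

locale abstract_state_space =
  fixes f :: "'a::{banach, ordered_real_vector} \<Rightarrow> real"
  assumes generating: "\<exists>u v. 0 \<le> u \<and> 0 \<le> v \<and> x = u - v"
    and linear_functional: "linear f"
    and strictly_positive: "0 \<le> x \<Longrightarrow> x \<noteq> 0 \<Longrightarrow> 0 < f x"
    and base: "is_base_of_cone (states f) {x. 0 \<le> x}"
    and norm_eq: "norm x = Inf {c. 0 \<le> c \<and> x \<in> (\<lambda>u. c *\<^sub>R u) ` state_unit_hull f}"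
    and closed_cone: "closed {x::'a. 0 \<le> x}"

section \<open>Markov semigroups\<close>

definition positive_operator :: "('a::ordered_real_vector \<Rightarrow> 'a) \<Rightarrow> bool" where
  "positive_operator T \<longleftrightarrow> linear T \<and> (\<forall>x. 0 \<le> x \<longrightarrow> 0 \<le> T x)"

definition markov :: "('a::ordered_real_vector \<Rightarrow> real) \<Rightarrow> ('a \<Rightarrow> 'a) \<Rightarrow> bool" where
  "markov f T \<longleftrightarrow> positive_operator T \<and> T ` states f \<subseteq> states f"

text \<open>A family indexed by \<open>t \<ge> 0\<close> is a function on \<open>real\<close> that is \<open>undefined\<close> at negative
  arguments (\<open>extensional\<close>), so that equality of functions is equality of families.\<close>

definition markov_semigroups ::
    "('a::{real_normed_vector, ordered_real_vector} \<Rightarrow> real) \<Rightarrow> (real \<Rightarrow> 'a \<Rightarrow> 'a) set" where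
  "markov_semigroups f =
     {T \<in> extensional {0..}.
        (\<forall>t\<ge>0. markov f (T t)) \<and>
        T 0 = id \<and>
        (\<forall>t\<ge>0. \<forall>s\<ge>0. T (t + s) = T t \<circ> T s) \<and>
        (\<forall>x. ((\<lambda>t. norm (T t x - x)) \<longlongrightarrow> 0) (at_right 0))}"

text \<open>Markov operators are bounded (lemma \<open>markov_bounded_linear\<close> below), and \<open>P\<close> is required
  to be bounded, so \<open>onorm\<close> is applied to bounded operators only.\<close>

definition uniformly_ergodic :: "(real \<Rightarrow> 'a \<Rightarrow> 'a::real_normed_vector) \<Rightarrow> bool" where
  "uniformly_ergodic T \<longleftrightarrow>
     (\<exists>P. bounded_linear P \<and> P \<circ> P = P \<and> dim (range P) = 1 \<and>
          ((\<lambda>t. onorm (\<lambda>x. T t x - P x)) \<longlongrightarrow> 0) at_top)"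

definition uniformly_ergodic_semigroups ::
    "('a::{real_normed_vector, ordered_real_vector} \<Rightarrow> real) \<Rightarrow> (real \<Rightarrow> 'a \<Rightarrow> 'a) set" where
  "uniformly_ergodic_semigroups f = {T \<in> markov_semigroups f. uniformly_ergodic T}"

text \<open>The value 0 outside the set of semigroups is needed because the locale \<open>Metric_space\<close>
  demands nonnegativity and symmetry of the distance function on the whole type.\<close>

definition rho1 ::
    "('a::{real_normed_vector, ordered_real_vector} \<Rightarrow> real)
      \<Rightarrow> (real \<Rightarrow> 'a \<Rightarrow> 'a) \<Rightarrow> (real \<Rightarrow> 'a \<Rightarrow> 'a) \<Rightarrow> real" where
  "rho1 f T S =
     (if T \<in> markov_semigroups f \<and> S \<in> markov_semigroups f
      then SUP t\<in>{0..1}. onorm (\<lambda>x. T t x - S t x) else 0)"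

abbreviation rho1_topology ::
    "('a::{real_normed_vector, ordered_real_vector} \<Rightarrow> real) \<Rightarrow> (real \<Rightarrow> 'a \<Rightarrow> 'a) topology" where
  "rho1_topology f \<equiv> Metric_space.mtopology (markov_semigroups f) (rho1 f)"

section \<open>\<open>rho1\<close> is a metric\<close>

context abstract_state_space
begin

lemma convex_unit_hull: "convex (state_unit_hull f)"
  by (simp add: state_unit_hull_def)

lemma gauge_nonempty: "\<exists>c\<ge>0. x \<in> (\<lambda>u. c *\<^sub>R u) ` state_unit_hull f"
proof -
  let ?U = "state_unit_hull f"
  interpret f: linear f by (rule linear_functional)
  obtain k where k: "k \<in> states f"
    using base by (auto simp: is_base_of_cone_def)
  have pos: "\<exists>c\<ge>0. \<exists>k\<in>states f. u = c *\<^sub>R k" if "0 \<le> u" for u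
  proof (cases "u = 0")
    case True then show ?thesis using k by (intro exI[of _ 0]) auto
  next
    case False
    then have "0 < f u" using strictly_positive that by blast
    then show ?thesis
      using that scaleR_nonneg_nonneg[of "inverse (f u)" u]
      by (intro exI[of _ "f u"] conjI bexI[of _ "inverse (f u) *\<^sub>R u"])
         (auto simp: states_def f.scaleR)
  qed
  obtain u v where uv: "0 \<le> u" "0 \<le> v" "x = u - v" using generating by blast
  obtain a p where a: "0 \<le> a" "p \<in> states f" "u = a *\<^sub>R p" using pos uv by blast
  obtain b q where b: "0 \<le> b" "q \<in> states f" "v = b *\<^sub>R q" using pos uv by blast
  have pU: "p \<in> ?U" and qU: "- q \<in> ?U"
    using a b by (auto simp: state_unit_hull_def intro: hull_inc)
  show ?thesis
  proof (cases "a + b = 0")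
    case True
    then have "a = 0" "b = 0" using a b by auto
    then show ?thesis using uv a b pU by (intro exI[of _ 0]) auto
  next
    case False
    then have ab: "a + b > 0" using a b by auto
    have "(a / (a + b)) *\<^sub>R p + (b / (a + b)) *\<^sub>R (- q) \<in> ?U"
      using a b ab pU qU
      by (intro convexD[OF convex_unit_hull]) (auto simp flip: add_divide_distrib)
    moreover have "x = (a + b) *\<^sub>R ((a / (a + b)) *\<^sub>R p + (b / (a + b)) *\<^sub>R (- q))"
      using ab uv a b by (simp add: scaleR_right_distrib scaleR_right_diff_distrib)
    ultimately show ?thesis using ab by (intro exI[of _ "a + b"]) auto
  qed
qed

lemma markov_image_hull:
  assumes "markov f T" "x \<in> state_unit_hull f"
  shows "T x \<in> state_unit_hull f"
proof -
  have lin: "linear T" and K: "T ` states f \<subseteq> states f"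
    using assms by (auto simp: markov_def positive_operator_def)
  have "T ` state_unit_hull f = convex hull (T ` (states f \<union> uminus ` states f))"
    unfolding state_unit_hull_def by (rule convex_hull_linear_image[OF lin])
  also have "\<dots> \<subseteq> state_unit_hull f"
    unfolding state_unit_hull_def
    using K by (intro hull_mono) (auto simp: linear_neg[OF lin])
  finally show ?thesis using assms(2) by blast
qed

lemma markov_norm_le:
  assumes "markov f T"
  shows "norm (T x) \<le> norm x"
proof -
  have lin: "linear T" using assms by (auto simp: markov_def positive_operator_def)
  show ?thesis
    unfolding norm_eq[of x] norm_eq[of "T x"]
  proof (rule cInf_superset_mono)
    show "{c. 0 \<le> c \<and> x \<in> (*\<^sub>R) c ` state_unit_hull f} \<noteq> {}"
      using gauge_nonempty[of x] by blast
    show "bdd_below {c. 0 \<le> c \<and> T x \<in> (*\<^sub>R) c ` state_unit_hull f}"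
      by (intro bdd_belowI[of _ 0]) auto
    show "{c. 0 \<le> c \<and> x \<in> (*\<^sub>R) c ` state_unit_hull f}
        \<subseteq> {c. 0 \<le> c \<and> T x \<in> (*\<^sub>R) c ` state_unit_hull f}"
      using markov_image_hull[OF assms] by (auto simp: linear_cmul[OF lin])
  qed
qed

lemma markov_bounded_linear:
  assumes "markov f T"
  shows "bounded_linear T"
proof (rule bounded_linear_intro[where K = 1])
  have lin: "linear T" using assms by (auto simp: markov_def positive_operator_def)
  show "T (x + y) = T x + T y" "T (r *\<^sub>R x) = r *\<^sub>R T x" for x y r
    by (simp_all add: linear_add[OF lin] linear_cmul[OF lin])
  show "norm (T x) \<le> norm x * 1" for x
    using markov_norm_le[OF assms] by simp
qed

lemma semigroup_bounded_linear:
  assumes "T \<in> markov_semigroups f" "t \<ge> 0"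
  shows "bounded_linear (T t)"
  using assms markov_bounded_linear by (auto simp: markov_semigroups_def)

lemma rho1_bdd_above:
  assumes "T \<in> markov_semigroups f" "S \<in> markov_semigroups f"
  shows "bdd_above ((\<lambda>t. onorm (\<lambda>x. T t x - S t x)) ` {0..1})"
proof (rule bdd_aboveI2)
  fix t :: real assume "t \<in> {0..1}"
  then have M: "markov f (T t)" "markov f (S t)"
    using assms by (auto simp: markov_semigroups_def)
  show "onorm (\<lambda>x. T t x - S t x) \<le> 2"
  proof (rule onorm_bound)
    show "norm (T t x - S t x) \<le> 2 * norm x" for x
      using norm_triangle_ineq4[of "T t x" "S t x"] markov_norm_le[OF M(1), of x]
        markov_norm_le[OF M(2), of x] by linarith
  qed simp
qed

lemma semigroup_eqI:
  assumes T: "T \<in> markov_semigroups f" and S: "S \<in> markov_semigroups f"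
    and eq: "\<And>t. t \<in> {0..1} \<Longrightarrow> T t = S t"
  shows "T = S"
proof (rule extensionalityI[where A = "{0..}"])
  show "T \<in> extensional {0..}" "S \<in> extensional {0..}"
    using T S by (auto simp: markov_semigroups_def)
  have upto: "\<forall>t. 0 \<le> t \<and> t \<le> real n \<longrightarrow> T t = S t" for n
  proof (induction n)
    case 0 then show ?case using eq by auto
  next
    case (Suc n)
    show ?case
    proof (intro allI impI)
      fix t :: real assume t: "0 \<le> t \<and> t \<le> real (Suc n)"
      show "T t = S t"
      proof (cases "t \<le> 1")
        case True then show ?thesis using eq t by auto
      next
        case False
        have law: "V (a + b) = V a \<circ> V b"
          if "V \<in> markov_semigroups f" "0 \<le> a" "0 \<le> b" for V a b
          using that by (simp add: markov_semigroups_def)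
        have "T ((t - 1) + 1) = T (t - 1) \<circ> T 1" "S ((t - 1) + 1) = S (t - 1) \<circ> S 1"
          using False by (intro law T S; simp)+
        moreover have "T (t - 1) = S (t - 1)" using Suc t False by auto
        ultimately show ?thesis using eq[of 1] by simp
      qed
    qed
  qed
  show "T t = S t" if "t \<in> {0..}" for t
    using upto[of "nat \<lceil>t\<rceil>"] that by (auto simp: of_nat_ceiling)
qed

lemma Metric_space_rho1: "Metric_space (markov_semigroups f) (rho1 f)"
proof
  fix T S :: "real \<Rightarrow> 'a \<Rightarrow> 'a"
  have upper: "onorm (\<lambda>x. T t x - S t x) \<le> rho1 f T S"
    if "T \<in> markov_semigroups f" "S \<in> markov_semigroups f" "t \<in> {0..1}" for T S t
    using cSUP_upper[OF that(3) rho1_bdd_above[OF that(1,2)]] that(1,2) by (simp add: rho1_def)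
  have bl: "bounded_linear (\<lambda>x. T t x - S t x)"
    if "T \<in> markov_semigroups f" "S \<in> markov_semigroups f" "t \<in> {0..1}" for T S t
    using that by (intro bounded_linear_sub semigroup_bounded_linear) auto
  have nonneg: "0 \<le> rho1 f T S" for T S
  proof (cases "T \<in> markov_semigroups f \<and> S \<in> markov_semigroups f")
    case True
    then have "0 \<le> onorm (\<lambda>x. T 0 x - S 0 x)" by (intro onorm_pos_le bl) auto
    also have "\<dots> \<le> rho1 f T S" using True by (intro upper) auto
    finally show ?thesis .
  qed (auto simp: rho1_def)
  show "0 \<le> rho1 f T S" by (rule nonneg)
  have "onorm (\<lambda>x. T t x - S t x) = onorm (\<lambda>x. S t x - T t x)" for t
    using onorm_neg[of "\<lambda>x. T t x - S t x"] by simp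
  then show "rho1 f T S = rho1 f S T"
    by (simp add: rho1_def)
  show "rho1 f T S = 0 \<longleftrightarrow> T = S" if TS: "T \<in> markov_semigroups f" "S \<in> markov_semigroups f"
  proof
    assume 0: "rho1 f T S = 0"
    show "T = S"
    proof (rule semigroup_eqI[OF TS])
      fix t :: real assume t: "t \<in> {0..1}"
      have "onorm (\<lambda>x. T t x - S t x) = 0"
        using upper[OF TS t] onorm_pos_le[OF bl[OF TS t]] 0 by simp
      then show "T t = S t" using onorm_eq_0[OF bl[OF TS t]] by auto
    qed
  next
    assume "T = S"
    then show "rho1 f T S = 0" by (simp add: rho1_def onorm_zero)
  qed
  fix R :: "real \<Rightarrow> 'a \<Rightarrow> 'a"
  show "rho1 f T R \<le> rho1 f T S + rho1 f S R"
    if M: "T \<in> markov_semigroups f" "S \<in> markov_semigroups f" "R \<in> markov_semigroups f"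
  proof -
    have "(SUP t\<in>{0..1}. onorm (\<lambda>x. T t x - R t x)) \<le> rho1 f T S + rho1 f S R"
    proof (rule cSUP_least)
      fix t :: real assume t: "t \<in> {0..1}"
      have "onorm (\<lambda>x. T t x - R t x) = onorm (\<lambda>x. (T t x - S t x) + (S t x - R t x))"
        by simp
      also have "\<dots> \<le> onorm (\<lambda>x. T t x - S t x) + onorm (\<lambda>x. S t x - R t x)"
        by (rule onorm_triangle[OF bl[OF M(1,2) t] bl[OF M(2,3) t]])
      also have "\<dots> \<le> rho1 f T S + rho1 f S R"
        by (rule add_mono[OF upper[OF M(1,2) t] upper[OF M(2,3) t]])
      finally show "onorm (\<lambda>x. T t x - R t x) \<le> rho1 f T S + rho1 f S R" .
    qed simp
    then show ?thesis using M by (simp add: rho1_def)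
  qed
qed

end

end

theory Submission
  imports Defs
begin

text \<open>
  Everything is governed by the hyperplane \<open>{x. f x = 0}\<close>, which every Markov operator leaves
  invariant. A semigroup is uniformly ergodic if and only if one of its operators is a strict
  contraction on this hyperplane (lemmas \<open>uniformly_ergodic_if_contracts_kernel\<close> and
  \<open>uniformly_ergodic_imp_contracts_kernel\<close>). For one direction, such an operator is a strict
  contraction of the complete set of states, so it has a fixed state \<open>y\<close>, and \<open>T t\<close> converges to
  \<open>x \<mapsto> f x *\<^sub>R y\<close> because \<open>x - f x *\<^sub>R y\<close> lies in the hyperplane. For the other, the limit
  projection inherits \<open>f \<circ> P = f\<close>; having rank one, it must vanish on the hyperplane.

  Openness follows because the contracting operator may be taken to be \<open>T n\<close> with \<open>n\<close> a natural
  number, and \<open>T n\<close> depends Lipschitz continuously on \<open>T 1\<close>.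

  For density, a given semigroup \<open>T\<close> is damped at a small rate \<open>c\<close>, and the mass lost is put
  back in a fixed way:
  \<open>S t x = exp (- c t) T t x + f x (y - exp (- c t) T t y)\<close>. Whenever \<open>f y = 1\<close>, this is a
  semigroup that preserves \<open>f\<close> and contracts the hyperplane by the factor \<open>exp (- c t)\<close>. It is
  positive if the differences \<open>y - exp (- c t) T t y\<close> lie in the cone; their norm is then
  their mass \<open>1 - exp (- c t)\<close>, so that \<open>S t\<close> is within \<open>2 (1 - exp (- c t))\<close> of \<open>T t\<close>. A \<open>y\<close>
  with this property is the resolvent \<open>\<integral> c exp (- c s) T s k ds\<close> over the half-line, for any
  state \<open>k\<close>; then the difference is the integral over \<open>[0, t]\<close>. It is obtained in
  \<open>dominating_vector_exists\<close>.
\<close>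

section \<open>The functional and the norm\<close>

context abstract_state_space
begin

text \<open>On the unit hull, \<open>f\<close> takes convex combinations of the values \<open>1\<close> and \<open>- 1\<close>.\<close>

lemma functional_abs_le_norm: "\<bar>f x\<bar> \<le> norm x"
proof -
  interpret f: linear f by (rule linear_functional)
  have U: "\<bar>f u\<bar> \<le> 1" if "u \<in> state_unit_hull f" for u
  proof -
    have "f ` state_unit_hull f = convex hull (f ` (states f \<union> uminus ` states f))"
      unfolding state_unit_hull_def by (rule convex_hull_linear_image[OF linear_functional])
    also have "\<dots> \<subseteq> {-1..1}"
      by (rule hull_minimal) (auto simp: states_def f.neg)
    finally show ?thesis using that by fastforce
  qed
  show ?thesis
    unfolding norm_eq
  proof (rule cInf_greatest)
    show "{c. 0 \<le> c \<and> x \<in> (*\<^sub>R) c ` state_unit_hull f} \<noteq> {}"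
      using gauge_nonempty[of x] by blast
    show "\<bar>f x\<bar> \<le> c" if "c \<in> {c. 0 \<le> c \<and> x \<in> (*\<^sub>R) c ` state_unit_hull f}" for c
    proof -
      from that obtain u where "0 \<le> c" "u \<in> state_unit_hull f" "x = c *\<^sub>R u" by auto
      then show ?thesis using U[of u] mult_left_mono[of "\<bar>f u\<bar>" 1 c]
        by (simp add: f.scaleR abs_mult)
    qed
  qed
qed

lemma bounded_linear_functional: "bounded_linear f"
  using linear_functional functional_abs_le_norm
  by (intro bounded_linear_intro[where K = 1]) (auto simp: linear_add linear_cmul)

lemma pos_eq_scaleR_state:
  assumes "0 \<le> x"
  obtains k where "k \<in> states f" "x = f x *\<^sub>R k"
proof (cases "x = 0")
  case True
  moreover obtain k where "k \<in> states f" using base by (auto simp: is_base_of_cone_def)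
  ultimately show ?thesis using that linear_0[OF linear_functional] by auto
next
  case False
  then have "0 < f x" using strictly_positive assms by blast
  then show ?thesis
    using assms scaleR_nonneg_nonneg[of "inverse (f x)" x]
    by (intro that[of "inverse (f x) *\<^sub>R x"])
       (auto simp: states_def linear_cmul[OF linear_functional])
qed

lemma functional_nonneg: "0 \<le> x \<Longrightarrow> 0 \<le> f x"
  using strictly_positive[of x] linear_0[OF linear_functional] by (cases "x = 0") auto

lemma norm_eq_functional_on_cone:
  assumes "0 \<le> x"
  shows "norm x = f x"
proof (rule antisym)
  obtain k where k: "k \<in> states f" "x = f x *\<^sub>R k" using pos_eq_scaleR_state[OF assms] .
  have "k \<in> state_unit_hull f"
    using k by (auto simp: state_unit_hull_def intro: hull_inc)
  then show "norm x \<le> f x"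
    unfolding norm_eq using k functional_nonneg[OF assms]
    by (intro cInf_lower bdd_belowI[of _ 0]) auto
  show "f x \<le> norm x" using functional_abs_le_norm[of x] by simp
qed

lemma closed_states: "closed (states f)"
proof -
  have "states f = {x. 0 \<le> x} \<inter> f -` {1}" by (auto simp: states_def)
  moreover have "closed (f -` {1})"
    by (intro continuous_closed_vimage linear_continuous_at bounded_linear_functional) simp
  ultimately show ?thesis using closed_cone by auto
qed

lemma norm_sub_functional_scaleR_le:
  assumes "y \<in> states f"
  shows "norm (x - f x *\<^sub>R y) \<le> 2 * norm x"
proof -
  have "norm y = 1" using assms norm_eq_functional_on_cone by (auto simp: states_def)
  then show ?thesis
    using norm_triangle_ineq4[of x "f x *\<^sub>R y"] functional_abs_le_norm[of x] by simp
qed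

section \<open>Markov operators and semigroups\<close>

lemma markov_functional:
  assumes "markov f T"
  shows "f (T x) = f x"
proof -
  have lin: "linear T" and K: "\<And>k. k \<in> states f \<Longrightarrow> T k \<in> states f"
    using assms by (auto simp: markov_def positive_operator_def)
  interpret f: linear f by (rule linear_functional)
  have pos: "f (T u) = f u" if u: "0 \<le> u" for u
  proof -
    obtain k where k: "k \<in> states f" "u = f u *\<^sub>R k" using pos_eq_scaleR_state[OF u] .
    have "f (T u) = f u * f (T k)"
      by (subst k(2)) (simp add: linear_cmul[OF lin] f.scaleR)
    then show ?thesis using K[OF k(1)] by (simp add: states_def)
  qed
  obtain u v where "0 \<le> u" "0 \<le> v" "x = u - v" using generating by blast
  then show ?thesis by (simp add: linear_diff[OF lin] f.diff pos)
qed

lemma markovI: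
  assumes "linear T" "\<And>x. 0 \<le> x \<Longrightarrow> 0 \<le> T x" "\<And>x. f (T x) = f x"
  shows "markov f T"
  using assms by (auto simp: markov_def positive_operator_def states_def)

lemma semigroup_markov: "T \<in> markov_semigroups f \<Longrightarrow> 0 \<le> t \<Longrightarrow> markov f (T t)"
  by (simp add: markov_semigroups_def)

lemma semigroup_add:
  "T \<in> markov_semigroups f \<Longrightarrow> 0 \<le> t \<Longrightarrow> 0 \<le> s \<Longrightarrow> T (t + s) x = T t (T s x)"
  by (simp add: markov_semigroups_def)

lemma semigroup_zero: "T \<in> markov_semigroups f \<Longrightarrow> T 0 = id"
  by (simp add: markov_semigroups_def)

text \<open>Contractivity turns the continuity at \<open>0\<close> into uniform continuity, from either side:
  \<open>T t x - T s x\<close> is the image of \<open>T (t - s) x - x\<close> under \<open>T s\<close>.\<close>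

lemma semigroup_continuous_on:
  assumes T: "T \<in> markov_semigroups f"
  shows "continuous_on {0..} (\<lambda>t. T t x)"
proof -
  have *: "norm (T t x - T s x) \<le> norm (T (t - s) x - x)" if "0 \<le> s" "s \<le> t" for s t
  proof -
    have lin: "linear (T s)"
      using semigroup_bounded_linear[OF T that(1)] by (rule bounded_linear.linear)
    have "T t x - T s x = T s (T (t - s) x - x)"
      using semigroup_add[OF T, of s "t - s" x] that by (simp add: linear_diff[OF lin])
    then show ?thesis using markov_norm_le[OF semigroup_markov[OF T that(1)]] by simp
  qed
  show ?thesis
    unfolding continuous_on_iff
  proof (intro ballI allI impI)
    fix s e :: real assume s: "s \<in> {0..}" and "0 < e"
    have "((\<lambda>t. norm (T t x - x)) \<longlongrightarrow> 0) (at_right 0)"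
      using T by (simp add: markov_semigroups_def)
    then have "eventually (\<lambda>t. norm (T t x - x) < e) (at_right 0)"
      using \<open>0 < e\<close> by (rule order_tendstoD)
    then obtain d where d: "0 < d" "\<And>t. 0 < t \<Longrightarrow> t < d \<Longrightarrow> norm (T t x - x) < e"
      by (auto simp: eventually_at_right_field)
    show "\<exists>d>0. \<forall>t\<in>{0..}. dist t s < d \<longrightarrow> dist (T t x) (T s x) < e"
    proof (intro exI[of _ d] conjI ballI impI d(1))
      fix t :: real assume t: "t \<in> {0..}" and dt: "dist t s < d"
      consider "t = s" | "s < t" | "t < s" by linarith
      then show "dist (T t x) (T s x) < e"
      proof cases
        case 1 then show ?thesis using \<open>0 < e\<close> by simp
      next
        case 2
        then show ?thesis using *[of s t] d(2)[of "t - s"] s dt by (auto simp: dist_norm)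
      next
        case 3
        then show ?thesis using *[of t s] d(2)[of "s - t"] t dt
          by (auto simp: dist_norm norm_minus_commute)
      qed
    qed
  qed
qed

lemma semigroup_contracts_kernel_power:
  assumes T: "T \<in> markov_semigroups f" and tau: "0 \<le> \<tau>" and q: "0 \<le> q"
    and contr: "\<And>x. f x = 0 \<Longrightarrow> norm (T \<tau> x) \<le> q * norm x"
    and x: "f x = 0" and t: "real m * \<tau> \<le> t"
  shows "norm (T t x) \<le> q ^ m * norm x"
  using t
proof (induction m arbitrary: t)
  case 0
  then show ?case using markov_norm_le[OF semigroup_markov[OF T]] by simp
next
  case (Suc m)
  then have t: "real m * \<tau> \<le> t - \<tau>" by (simp add: algebra_simps)
  then have nn: "0 \<le> t - \<tau>" using tau by (smt (verit) mult_nonneg_nonneg of_nat_0_le_iff)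
  have "T t x = T \<tau> (T (t - \<tau>) x)"
    using semigroup_add[OF T tau nn, of x] by simp
  also have "norm \<dots> \<le> q * norm (T (t - \<tau>) x)"
    using markov_functional[OF semigroup_markov[OF T nn]] x by (intro contr) simp
  also have "\<dots> \<le> q * (q ^ m * norm x)"
    by (intro mult_left_mono Suc.IH t q)
  finally show ?case by (simp add: mult.assoc)
qed

section \<open>Uniform ergodicity as contraction of the kernel\<close>

text \<open>The limit is \<open>x \<mapsto> f x *\<^sub>R y\<close>, where \<open>y\<close> is the fixed state of \<open>T \<tau>\<close>. Every \<open>T t\<close> commutes
  with \<open>T \<tau>\<close>, hence maps its unique fixed state to itself.\<close>

lemma uniformly_ergodic_if_contracts_kernel:
  assumes T: "T \<in> markov_semigroups f" and tau: "0 < \<tau>" and q: "0 \<le> q" "q < 1"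
    and contr: "\<And>x. f x = 0 \<Longrightarrow> norm (T \<tau> x) \<le> q * norm x"
  shows "uniformly_ergodic T"
proof -
  interpret f: bounded_linear f by (rule bounded_linear_functional)
  note mk = semigroup_markov[OF T]
  have lin: "linear (T t)" if "0 \<le> t" for t
    using semigroup_bounded_linear[OF T that] by (rule bounded_linear.linear)
  have st: "T t k \<in> states f" if "0 \<le> t" "k \<in> states f" for t k
    using mk[OF that(1)] that(2) by (auto simp: markov_def)
  have "\<exists>!y\<in>states f. T \<tau> y = y"
  proof (rule Banach_fix[OF _ _ q])
    show "complete (states f)" using closed_states by (simp add: complete_eq_closed)
    show "states f \<noteq> {}" using base by (simp add: is_base_of_cone_def)
    show "T \<tau> ` states f \<subseteq> states f" using st tau by auto
    show "dist (T \<tau> a) (T \<tau> b) \<le> q * dist a b" if "a \<in> states f" "b \<in> states f" for a b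
      using contr[of "a - b"] that tau
      by (simp add: dist_norm linear_diff[OF lin] f.diff states_def)
  qed
  then obtain y where y: "y \<in> states f" "T \<tau> y = y"
    and uniq: "\<And>z. z \<in> states f \<Longrightarrow> T \<tau> z = z \<Longrightarrow> z = y" by blast
  have fix_y: "T t y = y" if t: "0 \<le> t" for t
  proof (rule uniq)
    show "T t y \<in> states f" using st t y by blast
    show "T \<tau> (T t y) = T t y"
      using semigroup_add[OF T, of t \<tau> y] semigroup_add[OF T, of \<tau> t y] t tau y
      by (simp add: add.commute)
  qed
  have fy: "f y = 1" using y by (simp add: states_def)
  define P where "P x = f x *\<^sub>R y" for x
  have "y \<noteq> 0" using fy f.zero by auto
  have "range P = span {y}"
  proof -
    have "c *\<^sub>R y \<in> range P" for c
      by (intro image_eqI[of _ _ "c *\<^sub>R y"]) (simp_all add: P_def fy f.scaleR)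
    then show ?thesis by (auto simp: P_def span_singleton)
  qed
  then have dimP: "dim (range P) = 1"
    using \<open>y \<noteq> 0\<close> by (simp add: dim_eq_card_independent)
  have bP: "bounded_linear P"
    unfolding P_def
    by (rule bounded_linear_compose[OF bounded_linear_scaleR_left bounded_linear_functional])
  have bound: "onorm (\<lambda>x. T t x - P x) \<le> 2 * q ^ m" if t: "real m * \<tau> \<le> t" for m t
  proof (rule onorm_bound)
    fix x
    have t0: "0 \<le> t" using t tau by (smt (verit) mult_nonneg_nonneg of_nat_0_le_iff)
    have "T t x - P x = T t (x - f x *\<^sub>R y)"
      by (simp add: P_def linear_diff[OF lin[OF t0]] linear_cmul[OF lin[OF t0]] fix_y[OF t0])
    also have "norm \<dots> \<le> q ^ m * norm (x - f x *\<^sub>R y)"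
      using tau q contr t
      by (intro semigroup_contracts_kernel_power[OF T]) (auto simp: f.diff f.scaleR fy)
    also have "\<dots> \<le> q ^ m * (2 * norm x)"
      using q by (intro mult_left_mono norm_sub_functional_scaleR_le[OF y(1)]) auto
    finally show "norm (T t x - P x) \<le> 2 * q ^ m * norm x" by (simp add: mult_ac)
  qed (use q in simp)
  have "((\<lambda>t. onorm (\<lambda>x. T t x - P x)) \<longlongrightarrow> 0) at_top"
  proof (rule tendstoI)
    fix e :: real assume "0 < e"
    then obtain m where m: "q ^ m < e / 2"
      using real_arch_pow_inv[of "e / 2" q] q by auto
    show "eventually (\<lambda>t. dist (onorm (\<lambda>x. T t x - P x)) 0 < e) at_top"
      using eventually_ge_at_top[of "real m * \<tau>"]
    proof eventually_elim
      case (elim t)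
      then have "0 \<le> t" using tau by (smt (verit) mult_nonneg_nonneg of_nat_0_le_iff)
      then have "0 \<le> onorm (\<lambda>x. T t x - P x)"
        by (intro onorm_pos_le bounded_linear_sub bP semigroup_bounded_linear[OF T])
      then show ?case using bound[OF elim] m by simp
    qed
  qed
  moreover have "P \<circ> P = P" by (auto simp: P_def f.scaleR fy)
  ultimately show ?thesis using bP dimP unfolding uniformly_ergodic_def by blast
qed

text \<open>The limit \<open>P\<close> satisfies \<open>f \<circ> P = f\<close>, so a vector spanning its range is not annihilated by
  \<open>f\<close>. Hence \<open>P x = 0\<close> as soon as \<open>f x = 0\<close>, and \<open>T n\<close> is close to \<open>0\<close> on that hyperplane.\<close>

lemma uniformly_ergodic_imp_contracts_kernel:
  assumes T: "T \<in> markov_semigroups f" and erg: "uniformly_ergodic T"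
  obtains n :: nat where "0 < n" "\<And>x. f x = 0 \<Longrightarrow> norm (T (real n) x) \<le> 1 / 2 * norm x"
proof -
  interpret f: bounded_linear f by (rule bounded_linear_functional)
  obtain P where P: "bounded_linear P" "dim (range P) = 1"
    and lim: "((\<lambda>t. onorm (\<lambda>x. T t x - P x)) \<longlongrightarrow> 0) at_top"
    using erg by (auto simp: uniformly_ergodic_def)
  have lim_n: "(\<lambda>n. onorm (\<lambda>x. T (real n) x - P x)) \<longlonglongrightarrow> 0"
    using lim filterlim_real_sequentially by (rule filterlim_compose)
  have bl: "bounded_linear (\<lambda>x. T (real n) x - P x)" for n
    by (intro bounded_linear_sub P semigroup_bounded_linear[OF T]) simp
  have fP: "f (P x) = f x" for x
  proof -
    have "(\<lambda>n. onorm (\<lambda>x. T (real n) x - P x) * norm x) \<longlonglongrightarrow> 0"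
      using tendsto_mult_left_zero[OF lim_n] .
    then have "(\<lambda>n. T (real n) x - P x) \<longlonglongrightarrow> 0"
      by (rule Lim_null_comparison[rotated]) (simp add: onorm[OF bl])
    then have "(\<lambda>n. f (T (real n) x - P x)) \<longlonglongrightarrow> f 0" by (rule f.tendsto)
    then have "(\<lambda>n::nat. f x - f (P x)) \<longlonglongrightarrow> 0"
      by (simp add: f.diff markov_functional[OF semigroup_markov[OF T]])
    then show ?thesis by (simp add: LIMSEQ_const_iff)
  qed
  obtain B where B: "range P \<subseteq> span B" "card B = dim (range P)"
    using basis_exists[of "range P"] by metis
  have "card B = 1" using B(2) P(2) by (rule trans)
  then obtain v where "B = {v}" by (rule card_1_singletonE)
  then have v: "range P \<subseteq> span {v}" using B(1) by simp
  obtain k where "k \<in> states f" using base by (auto simp: is_base_of_cone_def)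
  then have "f (P k) = 1" by (simp add: fP states_def)
  moreover obtain c where "P k = c *\<^sub>R v" using v by (auto simp: span_singleton)
  ultimately have fv: "f v \<noteq> 0" by (auto simp: f.scaleR)
  have P0: "P x = 0" if "f x = 0" for x
  proof -
    obtain c where "P x = c *\<^sub>R v" using v by (auto simp: span_singleton)
    then show ?thesis using fP[of x] that fv by (simp add: f.scaleR)
  qed
  have "eventually (\<lambda>n. onorm (\<lambda>x. T (real n) x - P x) < 1 / 2 \<and> 0 < n) sequentially"
    using order_tendstoD(2)[OF lim_n, of "1 / 2"] eventually_gt_at_top[of 0]
    by (intro eventually_conj) simp_all
  then obtain n :: nat where n: "onorm (\<lambda>x. T (real n) x - P x) < 1 / 2" "0 < n"
    using eventually_happens'[OF sequentially_bot] by blast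
  show ?thesis
  proof (rule that[OF n(2)])
    fix x assume "f x = 0"
    then show "norm (T (real n) x) \<le> 1 / 2 * norm x"
      using onorm[OF bl[of n], of x] P0 n(1)
        mult_right_mono[of "onorm (\<lambda>x. T (real n) x - P x)" "1 / 2" "norm x"]
      by simp
  qed
qed

section \<open>Openness\<close>

lemma norm_diff_le_rho1:
  assumes T: "T \<in> markov_semigroups f" and S: "S \<in> markov_semigroups f" and t: "t \<in> {0..1}"
  shows "norm (T t x - S t x) \<le> rho1 f T S * norm x"
proof -
  have "bounded_linear (\<lambda>x. T t x - S t x)"
    using t by (intro bounded_linear_sub semigroup_bounded_linear T S) auto
  then have "norm (T t x - S t x) \<le> onorm (\<lambda>x. T t x - S t x) * norm x" by (rule onorm)
  also have "onorm (\<lambda>x. T t x - S t x) \<le> rho1 f T S"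
    using cSUP_upper[OF t rho1_bdd_above[OF T S]] T S by (simp add: rho1_def)
  finally show ?thesis by (simp add: mult_right_mono)
qed

text \<open>Telescoping: the semigroups are exchanged in one unit time step after the other, and all
  remaining steps are contractions.\<close>

lemma norm_diff_nat_le_rho1:
  assumes T: "T \<in> markov_semigroups f" and S: "S \<in> markov_semigroups f"
  shows "norm (T (real n) x - S (real n) x) \<le> real n * rho1 f T S * norm x"
proof (induction n arbitrary: x)
  case 0
  then show ?case by (simp add: semigroup_zero T S)
next
  case (Suc n)
  have lin: "linear (T (real n))"
    by (intro bounded_linear.linear semigroup_bounded_linear T) simp
  have Suc_eq: "real (Suc n) = real n + 1" by simp
  have "T (real (Suc n)) x - S (real (Suc n)) x
      = T (real n) (T 1 x - S 1 x) + (T (real n) (S 1 x) - S (real n) (S 1 x))"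
    unfolding Suc_eq by (simp add: semigroup_add[OF T] semigroup_add[OF S] linear_diff[OF lin])
  also have "norm \<dots> \<le> norm (T 1 x - S 1 x) + real n * rho1 f T S * norm (S 1 x)"
    by (intro norm_triangle_le add_mono Suc markov_norm_le semigroup_markov[OF T]) simp
  also have "\<dots> \<le> rho1 f T S * norm x + real n * rho1 f T S * norm x"
  proof (intro add_mono mult_left_mono)
    show "norm (T 1 x - S 1 x) \<le> rho1 f T S * norm x"
      by (rule norm_diff_le_rho1[OF T S]) simp
    show "norm (S 1 x) \<le> norm x"
      by (rule markov_norm_le[OF semigroup_markov[OF S]]) simp
    show "0 \<le> real n * rho1 f T S"
      using Metric_space.nonneg[OF Metric_space_rho1] by simp
  qed
  finally show ?case by (simp add: algebra_simps)
qed

lemma openin_uniformly_ergodic_semigroups: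
  "openin (rho1_topology f) (uniformly_ergodic_semigroups f)"
proof -
  interpret M: Metric_space "markov_semigroups f" "rho1 f" by (rule Metric_space_rho1)
  have "\<exists>r>0. M.mball T r \<subseteq> uniformly_ergodic_semigroups f"
    if "T \<in> uniformly_ergodic_semigroups f" for T
  proof -
    have T: "T \<in> markov_semigroups f" and erg: "uniformly_ergodic T"
      using that by (auto simp: uniformly_ergodic_semigroups_def)
    obtain n :: nat where n: "0 < n" "\<And>x. f x = 0 \<Longrightarrow> norm (T (real n) x) \<le> 1 / 2 * norm x"
      using uniformly_ergodic_imp_contracts_kernel[OF T erg] by blast
    \<comment> \<open>This radius lets the contraction factor of \<open>T n\<close> on the kernel grow by \<open>1 / 4\<close>, from
      \<open>1 / 2\<close> to \<open>3 / 4\<close>.\<close>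
    have "uniformly_ergodic S" if S: "S \<in> markov_semigroups f"
      and r: "rho1 f T S < 1 / (4 * real n)" for S
    proof (rule uniformly_ergodic_if_contracts_kernel[OF S, of "real n" "3 / 4"])
      fix x assume x: "f x = 0"
      have "real n * rho1 f T S \<le> 1 / 4" using r n(1) by (simp add: field_simps)
      then have "real n * rho1 f T S * norm x \<le> 1 / 4 * norm x" by (intro mult_right_mono) auto
      then show "norm (S (real n) x) \<le> 3 / 4 * norm x"
        using norm_diff_nat_le_rho1[OF T S, of n x] n(2)[OF x]
          norm_triangle_ineq3[of "T (real n) x" "S (real n) x"] by linarith
    qed (use n in auto)
    then show ?thesis using n(1)
      by (intro exI[of _ "1 / (4 * real n)"]) (auto simp: uniformly_ergodic_semigroups_def)
  qed
  then show ?thesis by (auto simp: M.openin_mtopology uniformly_ergodic_semigroups_def)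
qed

section \<open>A vector of mass one dominating its damped orbit\<close>

text \<open>Riemann sums of a cone-valued function lie in the cone, which is closed.\<close>

lemma has_integral_cone_nonneg:
  fixes a b :: real
  assumes I: "(h has_integral I) {a..b}" and pos: "\<And>s. s \<in> {a..b} \<Longrightarrow> 0 \<le> h s"
  shows "0 \<le> (I :: 'a)"
proof (rule ccontr)
  assume "\<not> 0 \<le> I"
  then obtain e where e: "0 < e" "ball I e \<subseteq> - {x. 0 \<le> x}"
    using closed_cone by (metis ComplI mem_Collect_eq open_Compl open_contains_ball)
  then obtain g where g: "gauge g"
    "\<And>p. p tagged_division_of {a..b} \<Longrightarrow> g fine p
      \<Longrightarrow> norm ((\<Sum>(x, k)\<in>p. measure lborel k *\<^sub>R h x) - I) < e"
    using I unfolding has_integral_real by metis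
  obtain p where p: "p tagged_division_of {a..b}" "g fine p"
    using fine_division_exists_real[OF g(1)] .
  have "0 \<le> (\<Sum>(x, k)\<in>p. measure lborel k *\<^sub>R h x)"
    using tag_in_interval[OF p(1)] pos
    by (intro sum_nonneg) (auto intro!: scaleR_nonneg_nonneg)
  moreover have "(\<Sum>(x, k)\<in>p. measure lborel k *\<^sub>R h x) \<in> ball I e"
    using g(2)[OF p] by (simp add: dist_norm norm_minus_commute)
  ultimately show False using e(2) by auto
qed

text \<open>With \<open>g t\<close> the integral of \<open>c exp (- c s) T s k\<close> over \<open>[0, t]\<close>, where \<open>k\<close> is any state, the
  semigroup law gives \<open>g (t + s) = g t + exp (- c t) T t (g s)\<close>. The integral over the half-line
  is the solution of \<open>y = g 1 + exp (- c) T 1 y\<close>, which the contraction principle provides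
  without a limit. The difference \<open>w\<close> of \<open>y - exp (- c t) T t y\<close> and \<open>g t\<close> solves the homogeneous
  equation \<open>w = exp (- c) T 1 w\<close>, hence vanishes for all \<open>t\<close>.\<close>

lemma dominating_vector_exists:
  assumes T: "T \<in> markov_semigroups f" and c: "0 < c"
  obtains y where "f y = 1" "\<And>t. 0 \<le> t \<Longrightarrow> 0 \<le> y - exp (- c * t) *\<^sub>R T t y"
proof -
  interpret f: bounded_linear f by (rule bounded_linear_functional)
  note mk = semigroup_markov[OF T] and bl = semigroup_bounded_linear[OF T]
  have lin: "linear (T t)" if "0 \<le> t" for t
    using bl[OF that] by (rule bounded_linear.linear)
  obtain k where k: "k \<in> states f" using base by (auto simp: is_base_of_cone_def)
  define u where "u s = (c * exp (- c * s)) *\<^sub>R T s k" for s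
  define g where "g t = integral {0..t} u" for t
  have cont: "continuous_on {0..} u"
    unfolding u_def by (intro continuous_intros semigroup_continuous_on[OF T])
  have int: "u integrable_on {a..b}" if "0 \<le> a" for a b
    using that by (intro integrable_continuous_interval continuous_on_subset[OF cont]) auto
  have g_nonneg: "0 \<le> g t" for t
    unfolding g_def
  proof (rule has_integral_cone_nonneg[OF integrable_integral[OF int]])
    fix s assume s: "s \<in> {0..t}"
    then have "0 \<le> T s k"
      using mk[of s] k by (auto simp: markov_def states_def)
    then show "0 \<le> u s" unfolding u_def using c by (intro scaleR_nonneg_nonneg) auto
  qed simp
  have g_add: "g (t + s) = g t + exp (- c * t) *\<^sub>R T t (g s)" if t: "0 \<le> t" and s: "0 \<le> s" for t s
  proof -
    have blh: "bounded_linear (\<lambda>x. exp (- c * t) *\<^sub>R T t x)"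
      using bl[OF t] by (rule bounded_linear_const_scaleR)
    have "exp (- c * t) *\<^sub>R T t (g s) = integral {0..s} ((\<lambda>x. exp (- c * t) *\<^sub>R T t x) \<circ> u)"
      unfolding g_def using integral_linear[OF int[of 0 s] blh] by simp
    also have "\<dots> = integral {0..s} (u \<circ> (+) t)"
    proof (rule integral_cong)
      fix r assume "r \<in> {0..s}"
      then have "T (t + r) k = T t (T r k)" using semigroup_add[OF T t] by simp
      moreover have "exp (- c * (t + r)) = exp (- c * t) * exp (- c * r)"
        by (simp add: algebra_simps flip: exp_add)
      ultimately show "((\<lambda>x. exp (- c * t) *\<^sub>R T t x) \<circ> u) r = (u \<circ> (+) t) r"
        by (simp add: u_def linear_cmul[OF lin[OF t]] mult_ac)
    qed
    also have "\<dots> = integral {t..t + s} u"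
      by (simp add: integral_shift_Icc_real add.commute)
    finally show ?thesis
      unfolding g_def using Henstock_Kurzweil_Integration.integral_combine[where a = 0 and c = t and b = "t + s" and f = u] int t s by simp
  qed
  have fg: "f (g 1) = 1 - exp (- c)"
  proof -
    have "f (g 1) = integral {0..1} (f \<circ> u)"
      unfolding g_def using integral_linear[OF int[of 0 1] bounded_linear_functional] by simp
    also have "\<dots> = integral {0..1} (\<lambda>s. c * exp (- c * s))"
      using k by (intro integral_cong)
        (simp add: u_def f.scaleR markov_functional[OF mk] states_def)
    also have "\<dots> = - exp (- c * 1) - (- exp (- c * 0))"
      by (intro integral_unique fundamental_theorem_of_calculus)
         (auto intro!: derivative_eq_intros simp flip: has_real_derivative_iff_has_vector_derivative)
    also have "\<dots> = 1 - exp (- c)" by simp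
    finally show ?thesis .
  qed
  have contr: "norm (exp (- c) *\<^sub>R T 1 a) \<le> exp (- c) * norm a" for a
    using markov_norm_le[OF mk[of 1], of a] by simp
  have e1: "exp (- c) < 1" using c by simp
  have "\<exists>!y. g 1 + exp (- c) *\<^sub>R T 1 y = y"
  proof (rule banach_fix_type[OF _ e1], safe)
    fix a b
    have "exp (- c) *\<^sub>R T 1 a - exp (- c) *\<^sub>R T 1 b = exp (- c) *\<^sub>R T 1 (a - b)"
      by (simp add: linear_diff[OF lin] scaleR_diff_right)
    then show "dist (g 1 + exp (- c) *\<^sub>R T 1 a) (g 1 + exp (- c) *\<^sub>R T 1 b) \<le> exp (- c) * dist a b"
      using contr[of "a - b"] by (simp add: dist_norm)
  qed simp
  then obtain y where y: "g 1 + exp (- c) *\<^sub>R T 1 y = y" by blast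
  have "f y = 1"
  proof -
    have "f y = f (g 1 + exp (- c) *\<^sub>R T 1 y)" by (simp only: y)
    also have "\<dots> = 1 - exp (- c) + exp (- c) * f y"
      by (simp add: f.add f.scaleR fg markov_functional[OF mk])
    finally have "(1 - exp (- c)) * (f y - 1) = 0" by (simp add: algebra_simps)
    then show ?thesis using e1 by simp
  qed
  moreover have "y - exp (- c * t) *\<^sub>R T t y = g t" if t: "0 \<le> t" for t
  proof -
    define w where "w = y - exp (- c * t) *\<^sub>R T t y - g t"
    have comm: "T 1 (T t y) = T t (T 1 y)"
      using semigroup_add[OF T t, of 1 y] semigroup_add[OF T _ t, of 1 y] by (simp add: add.commute)
    have T1y: "exp (- c) *\<^sub>R T 1 y = y - g 1" using y by (simp add: algebra_simps)
    have g1t: "exp (- c) *\<^sub>R T 1 (g t) = g (t + 1) - g 1"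
      using g_add[of 1 t] t by (simp add: add.commute)
    have gt1: "exp (- c * t) *\<^sub>R T t (g 1) = g (t + 1) - g t"
      using g_add[of t 1] t by simp
    have "exp (- c) *\<^sub>R T 1 w
        = exp (- c) *\<^sub>R T 1 y - exp (- c * t) *\<^sub>R T t (exp (- c) *\<^sub>R T 1 y) - exp (- c) *\<^sub>R T 1 (g t)"
      using t by (simp add: w_def linear_diff[OF lin] linear_cmul[OF lin] scaleR_diff_right comm
          mult.commute)
    also have "\<dots> = w"
      unfolding T1y g1t using t gt1
      by (simp add: w_def linear_diff[OF lin] scaleR_diff_right)
    finally have "norm w \<le> exp (- c) * norm w" using contr[of w] by simp
    then have "w = 0" using mult_strict_right_mono[OF e1, of "norm w"] by fastforce
    then show ?thesis by (simp add: w_def)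
  qed
  ultimately show ?thesis using that g_nonneg by metis
qed

section \<open>Density\<close>

text \<open>With \<open>A\<close> the generator of \<open>T\<close>, and \<open>y\<close> the resolvent integral of a state \<open>k\<close>, this is the
  semigroup generated by \<open>A + c (Q - I)\<close>, where \<open>Q x = f x *\<^sub>R k\<close>: at rate \<open>c\<close> the system is
  reset to \<open>k\<close>. The vector \<open>y\<close> is stationary.\<close>

definition refilled_semigroup :: "real \<Rightarrow> 'a \<Rightarrow> (real \<Rightarrow> 'a \<Rightarrow> 'a) \<Rightarrow> real \<Rightarrow> 'a \<Rightarrow> 'a" where
  "refilled_semigroup c y T = restrict
     (\<lambda>t x. exp (- c * t) *\<^sub>R T t x + f x *\<^sub>R (y - exp (- c * t) *\<^sub>R T t y)) {0..}"

lemma refilled_semigroup_nonneg_time: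
  "0 \<le> t \<Longrightarrow> refilled_semigroup c y T t x
    = exp (- c * t) *\<^sub>R T t x + f x *\<^sub>R (y - exp (- c * t) *\<^sub>R T t y)"
  by (simp add: refilled_semigroup_def)

lemma refilled_semigroup_in_markov_semigroups:
  assumes T: "T \<in> markov_semigroups f" and fy: "f y = 1"
    and pos: "\<And>t. 0 \<le> t \<Longrightarrow> 0 \<le> y - exp (- c * t) *\<^sub>R T t y"
  shows "refilled_semigroup c y T \<in> markov_semigroups f"
proof -
  interpret f: bounded_linear f by (rule bounded_linear_functional)
  define S where "S = refilled_semigroup c y T"
  have S: "S t x = exp (- c * t) *\<^sub>R T t x + f x *\<^sub>R (y - exp (- c * t) *\<^sub>R T t y)" if "0 \<le> t" for t x
    using that by (simp add: S_def refilled_semigroup_nonneg_time)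
  note mk = semigroup_markov[OF T]
  have lin: "linear (T t)" if "0 \<le> t" for t
    using semigroup_bounded_linear[OF T that] by (rule bounded_linear.linear)
  have markov_S: "markov f (S t)" if t: "0 \<le> t" for t
  proof (rule markovI)
    show "linear (S t)"
      by (rule linearI) (simp_all add: S[OF t] linear_add[OF lin[OF t]] linear_cmul[OF lin[OF t]]
          f.add f.scaleR algebra_simps)
    show "f (S t x) = f x" for x
      by (simp add: S[OF t] f.add f.diff f.scaleR markov_functional[OF mk[OF t]] fy algebra_simps)
    show "0 \<le> S t x" if x: "0 \<le> x" for x
    proof -
      have "0 \<le> T t x" using mk[OF t] x by (auto simp: markov_def positive_operator_def)
      then show ?thesis unfolding S[OF t]
        by (intro add_nonneg_nonneg scaleR_nonneg_nonneg pos t functional_nonneg x) auto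
    qed
  qed
  have law: "S (t + s) x = S t (S s x)" if t: "0 \<le> t" and s: "0 \<le> s" for t s x
  proof -
    have fS: "f (S s x) = f x" using markov_functional[OF markov_S[OF s]] .
    have e: "exp (- c * (t + s)) = exp (- c * t) * exp (- c * s)"
      by (simp add: algebra_simps flip: exp_add)
    have "S t (S s x) = exp (- c * t) *\<^sub>R T t (S s x) + f x *\<^sub>R (y - exp (- c * t) *\<^sub>R T t y)"
      using S[OF t, of "S s x"] fS by simp
    also have "T t (S s x) = exp (- c * s) *\<^sub>R T (t + s) x
        + f x *\<^sub>R (T t y - exp (- c * s) *\<^sub>R T (t + s) y)"
      using lin[OF t] by (simp add: S[OF s] semigroup_add[OF T t s] linear_add linear_cmul linear_diff)
    finally have "S t (S s x) = exp (- c * t) *\<^sub>R (exp (- c * s) *\<^sub>R T (t + s) x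
        + f x *\<^sub>R (T t y - exp (- c * s) *\<^sub>R T (t + s) y))
        + f x *\<^sub>R (y - exp (- c * t) *\<^sub>R T t y)" .
    moreover have "S (t + s) x = (exp (- c * t) * exp (- c * s)) *\<^sub>R T (t + s) x
        + f x *\<^sub>R (y - (exp (- c * t) * exp (- c * s)) *\<^sub>R T (t + s) y)"
      using S[of "t + s" x] t s e by simp
    ultimately show ?thesis
      by (simp add: scaleR_add_right scaleR_diff_right mult_ac)
  qed
  have zero: "S 0 = id" by (rule ext) (simp add: S semigroup_zero[OF T])
  have cont: "((\<lambda>t. norm (S t x - x)) \<longlongrightarrow> 0) (at_right 0)" for x
  proof -
    have T0: "((\<lambda>t. T t z) \<longlongrightarrow> z) (at_right 0)" for z
    proof -
      have "((\<lambda>t. norm (T t z - z)) \<longlongrightarrow> 0) (at_right 0)"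
        using T by (simp add: markov_semigroups_def)
      then show ?thesis by (simp add: tendsto_norm_zero_iff LIM_zero_iff)
    qed
    have "((\<lambda>t. exp (- c * t) *\<^sub>R T t x + f x *\<^sub>R (y - exp (- c * t) *\<^sub>R T t y) - x)
        \<longlongrightarrow> exp (- c * 0) *\<^sub>R x + f x *\<^sub>R (y - exp (- c * 0) *\<^sub>R y) - x) (at_right 0)"
      by (intro tendsto_intros T0)
    then have "((\<lambda>t. norm (exp (- c * t) *\<^sub>R T t x + f x *\<^sub>R (y - exp (- c * t) *\<^sub>R T t y) - x))
        \<longlongrightarrow> 0) (at_right 0)"
      by (intro tendsto_norm_zero) simp
    then show ?thesis
      by (rule Lim_transform_eventually)
         (auto simp: S intro: eventually_mono[OF eventually_at_right_less[of 0]])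
  qed
  have "S \<in> extensional {0..}" by (simp add: S_def refilled_semigroup_def)
  then show ?thesis
    unfolding S_def[symmetric] markov_semigroups_def
    using markov_S law zero cont by (auto simp: fun_eq_iff)
qed

lemma refilled_semigroup_uniformly_ergodic:
  assumes T: "T \<in> markov_semigroups f" and c: "0 < c"
    and S: "refilled_semigroup c y T \<in> markov_semigroups f"
  shows "uniformly_ergodic (refilled_semigroup c y T)"
proof (rule uniformly_ergodic_if_contracts_kernel[OF S, of 1 "exp (- c)"])
  fix x assume "f x = 0"
  then show "norm (refilled_semigroup c y T 1 x) \<le> exp (- c) * norm x"
    using markov_norm_le[OF semigroup_markov[OF T, of 1], of x]
    by (simp add: refilled_semigroup_nonneg_time)
qed (use c in auto)

text \<open>The difference to \<open>T t\<close> consists of the damping of \<open>T t x\<close> and of a positive vector times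
  \<open>f x\<close>. On the cone the norm is \<open>f\<close>, so both terms have size at most
  \<open>1 - exp (- c t) \<le> c\<close>, relative to \<open>x\<close>.\<close>

lemma rho1_refilled_semigroup_le:
  assumes T: "T \<in> markov_semigroups f" and c: "0 < c" and fy: "f y = 1"
    and pos: "\<And>t. 0 \<le> t \<Longrightarrow> 0 \<le> y - exp (- c * t) *\<^sub>R T t y"
    and S: "refilled_semigroup c y T \<in> markov_semigroups f"
  shows "rho1 f T (refilled_semigroup c y T) \<le> 2 * c"
proof -
  interpret f: bounded_linear f by (rule bounded_linear_functional)
  have "onorm (\<lambda>x. T t x - refilled_semigroup c y T t x) \<le> 2 * c" if "t \<in> {0..1}" for t
  proof (rule onorm_bound)
    fix x
    from that have t: "0 \<le> t" "t \<le> 1" by auto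
    define g where "g = y - exp (- c * t) *\<^sub>R T t y"
    have "norm g = f g" unfolding g_def by (intro norm_eq_functional_on_cone pos t)
    also have "f g = 1 - exp (- c * t)"
      by (simp add: g_def f.diff f.scaleR markov_functional[OF semigroup_markov[OF T t(1)]] fy)
    finally have ng: "norm g = 1 - exp (- c * t)" .
    have nn: "0 \<le> 1 - exp (- c * t)" using c t by simp
    have "1 - exp (- c * t) \<le> c * t" using exp_ge_add_one_self[of "- c * t"] by simp
    also have "\<dots> \<le> c" using c t by (simp add: mult_left_le)
    finally have ec: "1 - exp (- c * t) \<le> c" .
    have "T t x - refilled_semigroup c y T t x = (1 - exp (- c * t)) *\<^sub>R T t x - f x *\<^sub>R g"
      by (simp add: refilled_semigroup_nonneg_time t g_def scaleR_diff_left)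
    also have "norm \<dots> \<le> (1 - exp (- c * t)) * norm (T t x) + \<bar>f x\<bar> * (1 - exp (- c * t))"
      using norm_triangle_ineq4[of "(1 - exp (- c * t)) *\<^sub>R T t x" "f x *\<^sub>R g"] nn by (simp add: ng)
    also have "\<dots> \<le> c * norm x + norm x * c"
      using nn ec c
      by (intro add_mono mult_mono markov_norm_le semigroup_markov[OF T t(1)] functional_abs_le_norm) auto
    finally show "norm (T t x - refilled_semigroup c y T t x) \<le> 2 * c * norm x"
      by (simp add: algebra_simps)
  qed (use c in simp)
  then show ?thesis using T S by (auto simp: rho1_def intro!: cSUP_least)
qed

lemma uniformly_ergodic_semigroups_dense:
  "rho1_topology f closure_of uniformly_ergodic_semigroups f = markov_semigroups f"
proof -
  interpret M: Metric_space "markov_semigroups f" "rho1 f" by (rule Metric_space_rho1)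
  have "\<exists>S\<in>uniformly_ergodic_semigroups f. S \<in> M.mball T r"
    if T: "T \<in> markov_semigroups f" and r: "0 < r" for T r
  proof -
    have c: "0 < r / 3" using r by simp
    obtain y where y: "f y = 1" "\<And>t. 0 \<le> t \<Longrightarrow> 0 \<le> y - exp (- (r / 3) * t) *\<^sub>R T t y"
      using dominating_vector_exists[OF T c] by blast
    note S = refilled_semigroup_in_markov_semigroups[OF T y]
    show ?thesis
      using rho1_refilled_semigroup_le[OF T c y S] refilled_semigroup_uniformly_ergodic[OF T c S] S T r
      by (intro bexI[of _ "refilled_semigroup (r / 3) y T"])
         (auto simp: uniformly_ergodic_semigroups_def)
  qed
  then show ?thesis by (auto simp: M.metric_closure_of)
qed

end

theorem theorem3p11:
  fixes f :: "'a::{banach, ordered_real_vector} \<Rightarrow> real"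
  assumes "abstract_state_space f"
  shows "rho1_topology f closure_of uniformly_ergodic_semigroups f = markov_semigroups f \<and>
         openin (rho1_topology f) (uniformly_ergodic_semigroups f)"
  using abstract_state_space.uniformly_ergodic_semigroups_dense[OF assms]
    abstract_state_space.openin_uniformly_ergodic_semigroups[OF assms] by blast

end
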